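(* Let $N\ge1$ and let $A$ be an $N\times N$ integer matrix. Then $A=\mathcal{C}(b)$ for some braid $b\in\mathfrak{B}_N$ if and only if $A$ has an $SR$ decomposition, i.e. $A=S+R$ where $S$ is a symmetric integer $N\times N$ matrix with zero diagonal and $R$ is an $R$-matrix.
   Context: $\mathfrak{B}_N$ is the $N$-strand braid group with standard Artin generators $\sigma_1,\dots,\sigma_{N-1}$. Braids are drawn going downward; the product $ab$ is $a$ followed (below) by $b$. Strands are numbered $1,\dots,N$ from left to right by their starting positions. A crossing is positive if the strand that is on the left just before the crossing passes over the one on the right (this is $\sigma_i$, at positions $i,i+1$), and negative if the right strand passes over the left one ($\sigma_i^{-1}$). The crossing matrix $\mathcal{C}(b)$ is the $N\times N$ integer matrix with zero diagonal whose $(i,j)$ entry ($i\ne j$) is the number of positive crossings in which strand $i$ passes over strand $j$ minus the number of negative crossings in which strand $i$ passes over strand $j$; it depends only on the braid $b$, not on the geometric representative. A square matrix $A=(a_{ij})$ is $T0$ if for all $i<k<j$, $a_{ik}=0$ and $a_{kj}=0$ imply $a_{ij}=0$; it is $T1$ if for all $i<k<j$, $a_{ik}\neq0$ and $a_{kj}\ne0$ imply $a_{ij}\neq0$. An $R$-matrix is a strictly upper triangular matrix with all nonzero entries equal to $1$ that is both $T0$ and $T1$. *)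

theory Defs
  imports "Jordan_Normal_Form.Matrix" "HOL-Algebra.Group"
begin

text \<open>
  Positions, strands and matrix indices are numbered from 0, in line with the indexing of
  \<^typ>\<open>int mat\<close>: \<open>Sig i\<close> is the Artin generator $\sigma_{i+1}$, acting on the (0-based)
  positions \<open>i\<close> and \<open>i + 1\<close>, and \<open>SigInv i\<close> is its inverse. A word is read
  from left to right, that is, from the top of the braid downwards.
\<close>

section \<open>The braid group on $N$ strands\<close>

datatype artin_letter = Sig nat | SigInv nat

type_synonym braid_word = "artin_letter list"

fun letter_index :: "artin_letter \<Rightarrow> nat" where
  "letter_index (Sig i) = i"
| "letter_index (SigInv i) = i"

definition braid_words :: "nat \<Rightarrow> braid_word set" where
  "braid_words N = lists {l. Suc (letter_index l) < N}"

inductive braid_eq :: "nat \<Rightarrow> braid_word \<Rightarrow> braid_word \<Rightarrow> bool" for N :: nat where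
  refl: "w \<in> braid_words N \<Longrightarrow> braid_eq N w w"
| sym: "braid_eq N v w \<Longrightarrow> braid_eq N w v"
| trans: "braid_eq N u v \<Longrightarrow> braid_eq N v w \<Longrightarrow> braid_eq N u w"
| append: "braid_eq N u u' \<Longrightarrow> braid_eq N v v' \<Longrightarrow> braid_eq N (u @ v) (u' @ v')"
| right_inv: "Suc i < N \<Longrightarrow> braid_eq N [Sig i, SigInv i] []"
| left_inv: "Suc i < N \<Longrightarrow> braid_eq N [SigInv i, Sig i] []"
| far: "Suc i < j \<Longrightarrow> Suc j < N \<Longrightarrow> braid_eq N [Sig i, Sig j] [Sig j, Sig i]"
| braid: "Suc (Suc i) < N \<Longrightarrow>
    braid_eq N [Sig i, Sig (Suc i), Sig i] [Sig (Suc i), Sig i, Sig (Suc i)]"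

definition braid_rel :: "nat \<Rightarrow> (braid_word \<times> braid_word) set" where
  "braid_rel N = {(v, w). braid_eq N v w}"

definition braid_group :: "nat \<Rightarrow> braid_word set monoid" where
  "braid_group N =
    \<lparr>carrier = braid_words N // braid_rel N,
     mult = (\<lambda>X Y. \<Union>u\<in>X. \<Union>v\<in>Y. braid_rel N `` {u @ v}),
     one = braid_rel N `` {[]}\<rparr>"

lemma Nil_braid_words [simp]: "[] \<in> braid_words N"
  by (simp add: braid_words_def)

lemma Cons_braid_words [simp]:
  "l # w \<in> braid_words N \<longleftrightarrow> Suc (letter_index l) < N \<and> w \<in> braid_words N"
  by (auto simp: braid_words_def)

lemma append_braid_words [simp]:
  "u @ v \<in> braid_words N \<longleftrightarrow> u \<in> braid_words N \<and> v \<in> braid_words N"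
  by (auto simp: braid_words_def)

lemma braid_eq_words:
  "braid_eq N v w \<Longrightarrow> v \<in> braid_words N \<and> w \<in> braid_words N"
  by (induction rule: braid_eq.induct) auto

lemma equiv_braid_rel: "equiv (braid_words N) (braid_rel N)"
proof (rule equivI)
  show "braid_rel N \<subseteq> braid_words N \<times> braid_words N"
    by (auto simp: braid_rel_def dest: braid_eq_words)
  show "refl_on (braid_words N) (braid_rel N)"
    by (auto simp: braid_rel_def refl_on_def intro: braid_eq.refl)
  show "sym_on UNIV (braid_rel N)"
    by (auto simp: braid_rel_def sym_on_def intro: braid_eq.sym)
  show "trans_on UNIV (braid_rel N)"
    by (auto simp: braid_rel_def trans_on_def intro: braid_eq.trans)
qed

lemma mult_braid_group:
  assumes "u \<in> braid_words N" "v \<in> braid_words N"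
  shows "(braid_rel N `` {u}) \<otimes>\<^bsub>braid_group N\<^esub> (braid_rel N `` {v}) = braid_rel N `` {u @ v}"
proof -
  have "congruent2 (braid_rel N) (braid_rel N) (\<lambda>u v. braid_rel N `` {u @ v})"
  proof (rule congruent2I')
    fix u u' v v' assume "(u, u') \<in> braid_rel N" "(v, v') \<in> braid_rel N"
    then have "(u @ v, u' @ v') \<in> braid_rel N"
      by (simp add: braid_rel_def braid_eq.append)
    then show "braid_rel N `` {u @ v} = braid_rel N `` {u' @ v'}"
      by (rule equiv_class_eq[OF equiv_braid_rel])
  qed
  from UN_equiv_class2[OF equiv_braid_rel equiv_braid_rel this assms]
  show ?thesis by (simp add: braid_group_def)
qed

fun inv_letter :: "artin_letter \<Rightarrow> artin_letter" where
  "inv_letter (Sig i) = SigInv i"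
| "inv_letter (SigInv i) = Sig i"

definition inv_word :: "braid_word \<Rightarrow> braid_word" where
  "inv_word w = rev (map inv_letter w)"

lemma inv_word_words: "w \<in> braid_words N \<Longrightarrow> inv_word w \<in> braid_words N"
proof (induction w)
  case (Cons l w)
  then show ?case by (cases l) (auto simp: inv_word_def)
qed (simp add: inv_word_def)

lemma inv_word_left: "w \<in> braid_words N \<Longrightarrow> braid_eq N (inv_word w @ w) []"
proof (induction w)
  case Nil
  then show ?case by (simp add: inv_word_def braid_eq.refl)
next
  case (Cons l w)
  have l: "braid_eq N [inv_letter l, l] []"
    using Cons.prems by (cases l) (auto intro: braid_eq.intros)
  have w: "w \<in> braid_words N" "inv_word w \<in> braid_words N"
    using Cons.prems by (auto intro: inv_word_words)
  have "braid_eq N (inv_word w @ [inv_letter l, l] @ w) (inv_word w @ [] @ w)"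
    using l w by (intro braid_eq.append braid_eq.refl) auto
  then have "braid_eq N (inv_word w @ [inv_letter l, l] @ w) []"
    using Cons.IH w by (auto intro: braid_eq.trans)
  then show ?case by (simp add: inv_word_def)
qed

lemma group_braid_group: "group (braid_group N)"
proof (rule groupI)
  have carr: "carrier (braid_group N) = braid_words N // braid_rel N"
    and one: "\<one>\<^bsub>braid_group N\<^esub> = braid_rel N `` {[]}"
    by (simp_all add: braid_group_def)
  show "\<one>\<^bsub>braid_group N\<^esub> \<in> carrier (braid_group N)"
    by (auto simp: carr one intro: quotientI)
  fix x assume x: "x \<in> carrier (braid_group N)"
  then obtain u where u: "u \<in> braid_words N" "x = braid_rel N `` {u}"
    by (auto simp: carr elim: quotientE)
  show "\<one>\<^bsub>braid_group N\<^esub> \<otimes>\<^bsub>braid_group N\<^esub> x = x"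
    using u by (simp add: one mult_braid_group)
  have "braid_rel N `` {inv_word u @ u} = braid_rel N `` {[]}"
    using inv_word_left[OF u(1)]
    by (intro equiv_class_eq[OF equiv_braid_rel]) (simp add: braid_rel_def)
  then show "\<exists>y\<in>carrier (braid_group N). y \<otimes>\<^bsub>braid_group N\<^esub> x = \<one>\<^bsub>braid_group N\<^esub>"
    using u inv_word_words[OF u(1)]
    by (intro bexI[of _ "braid_rel N `` {inv_word u}"])
      (auto simp: one carr mult_braid_group intro: quotientI)
  fix y assume "y \<in> carrier (braid_group N)"
  then obtain v where v: "v \<in> braid_words N" "y = braid_rel N `` {v}"
    by (auto simp: carr elim: quotientE)
  show "x \<otimes>\<^bsub>braid_group N\<^esub> y \<in> carrier (braid_group N)"
    using u v by (auto simp: carr mult_braid_group intro: quotientI)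
  fix z assume "z \<in> carrier (braid_group N)"
  then obtain w where w: "w \<in> braid_words N" "z = braid_rel N `` {w}"
    by (auto simp: carr elim: quotientE)
  show "x \<otimes>\<^bsub>braid_group N\<^esub> y \<otimes>\<^bsub>braid_group N\<^esub> z =
      x \<otimes>\<^bsub>braid_group N\<^esub> (y \<otimes>\<^bsub>braid_group N\<^esub> z)"
    using u v w by (simp add: mult_braid_group)
qed

section \<open>The crossing matrix\<close>

datatype crossing = PosCr (over: nat) (under: nat) | NegCr (over: nat) (under: nat)

text \<open>
  The crossings of the diagram of a word, from top to bottom, where \<open>p k\<close> is the strand
  currently at position \<open>k\<close>. At a positive crossing the left strand passes over the right
  one, at a negative crossing the right strand passes over the left one.
\<close>

fun crossings :: "(nat \<Rightarrow> nat) \<Rightarrow> braid_word \<Rightarrow> crossing list" where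
  "crossings p [] = []"
| "crossings p (Sig i # w) =
    PosCr (p i) (p (Suc i)) # crossings (p(i := p (Suc i), Suc i := p i)) w"
| "crossings p (SigInv i # w) =
    NegCr (p (Suc i)) (p i) # crossings (p(i := p (Suc i), Suc i := p i)) w"

definition signed_count :: "crossing list \<Rightarrow> nat \<Rightarrow> nat \<Rightarrow> int" where
  "signed_count cs i j =
    int (count_list cs (PosCr i j)) - int (count_list cs (NegCr i j))"

definition crossing_matrix_word :: "nat \<Rightarrow> braid_word \<Rightarrow> int mat" where
  "crossing_matrix_word N w =
    mat N N (\<lambda>(i, j). if i = j then 0 else signed_count (crossings id w) i j)"

text \<open>
  On a braid, i.e. a class of words, this is the common value on all representatives;
  see \<open>crossing_matrix_class\<close>.
\<close>

definition crossing_matrix :: "nat \<Rightarrow> braid_word set \<Rightarrow> int mat" where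
  "crossing_matrix N b = the_elem (crossing_matrix_word N ` b)"

fun end_positions :: "(nat \<Rightarrow> nat) \<Rightarrow> braid_word \<Rightarrow> nat \<Rightarrow> nat" where
  "end_positions p [] = p"
| "end_positions p (l # w) =
    end_positions (p(letter_index l := p (Suc (letter_index l)),
                     Suc (letter_index l) := p (letter_index l))) w"

lemma end_positions_append: "end_positions p (u @ v) = end_positions (end_positions p u) v"
  by (induction p u rule: end_positions.induct) (simp_all del: fun_upd_apply)

lemma crossings_append: "crossings p (u @ v) = crossings p u @ crossings (end_positions p u) v"
  by (induction p u rule: crossings.induct) (simp_all del: fun_upd_apply)

lemma signed_count_append: "signed_count (cs @ ds) i j = signed_count cs i j + signed_count ds i j"
  by (simp add: signed_count_def)

lemma braid_eq_invariant:
  assumes "braid_eq N v w"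
  shows "end_positions p v = end_positions p w \<and>
    signed_count (crossings p v) a b = signed_count (crossings p w) a b"
  using assms
proof (induction arbitrary: p rule: braid_eq.induct)
  case (append u u' v v')
  then show ?case by (simp add: end_positions_append crossings_append signed_count_append)
qed (auto simp: signed_count_def fun_eq_iff)

lemma crossing_matrix_class:
  assumes "w \<in> braid_words N"
  shows "crossing_matrix N (braid_rel N `` {w}) = crossing_matrix_word N w"
proof -
  have "crossing_matrix_word N v = crossing_matrix_word N w" if "(w, v) \<in> braid_rel N" for v
  proof -
    from that have "signed_count (crossings id v) = signed_count (crossings id w)"
      using braid_eq_invariant[of N w v id] by (intro ext) (simp add: braid_rel_def)
    then show ?thesis
      unfolding crossing_matrix_word_def
      by (rule arg_cong[where f = "\<lambda>f. mat N N (\<lambda>(i, j). if i = j then 0 else f i j)"])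
  qed
  moreover have "w \<in> braid_rel N `` {w}"
    using assms by (simp add: braid_rel_def braid_eq.refl)
  ultimately have "crossing_matrix_word N ` (braid_rel N `` {w}) = {crossing_matrix_word N w}"
    by blast
  then show ?thesis by (simp add: crossing_matrix_def)
qed

section \<open>$SR$ decompositions\<close>

definition T0 :: "int mat \<Rightarrow> bool" where
  "T0 A \<longleftrightarrow> (\<forall>i k j. i < k \<and> k < j \<and> j < dim_row A \<longrightarrow>
    A $$ (i, k) = 0 \<longrightarrow> A $$ (k, j) = 0 \<longrightarrow> A $$ (i, j) = 0)"

definition T1 :: "int mat \<Rightarrow> bool" where
  "T1 A \<longleftrightarrow> (\<forall>i k j. i < k \<and> k < j \<and> j < dim_row A \<longrightarrow>
    A $$ (i, k) \<noteq> 0 \<longrightarrow> A $$ (k, j) \<noteq> 0 \<longrightarrow> A $$ (i, j) \<noteq> 0)"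

definition R_matrix :: "int mat \<Rightarrow> bool" where
  "R_matrix R \<longleftrightarrow> square_mat R \<and>
    (\<forall>i < dim_row R. \<forall>j \<le> i. R $$ (i, j) = 0) \<and>
    (\<forall>i < dim_row R. \<forall>j < dim_row R. R $$ (i, j) \<noteq> 0 \<longrightarrow> R $$ (i, j) = 1) \<and>
    T0 R \<and> T1 R"

definition SR_decomposable :: "nat \<Rightarrow> int mat \<Rightarrow> bool" where
  "SR_decomposable N A \<longleftrightarrow>
    (\<exists>S \<in> carrier_mat N N. \<exists>R \<in> carrier_mat N N.
      transpose_mat S = S \<and> (\<forall>i < N. S $$ (i, i) = 0) \<and> R_matrix R \<and> A = S + R)"

end

theory Submission
  imports Defs "HOL-Combinatorics.Transposition"
begin

text \<open>
  Two strands change sides at each of their crossings, so for any pair of strands the crossings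
  alternate between those where the first strand is on the left and those where the second one
  is. With the given signs, a crossing with \<open>s\<close> on the left raises
  \<open>c\<^sub>s\<^sub>t - c\<^sub>t\<^sub>s\<close> by one and a crossing with \<open>t\<close> on the left lowers it by one, whichever strand is
  on top. Hence \<open>c\<^sub>s\<^sub>t - c\<^sub>t\<^sub>s\<close> sees only the permutation of the braid
  (\<open>crossing_balance\<close>): for \<open>s < t\<close> it is 1 if the braid reverses the two strands, and 0
  otherwise. The antisymmetric part of a crossing matrix is thus the 0-1 matrix of inversions of a
  permutation, which satisfies \<open>T0\<close> and \<open>T1\<close> because "lies to the left of" is a linear
  order; what remains is symmetric.

  Conversely, the product of a pure braid with matrix \<open>S\<close> and any braid with matrix \<open>R\<close>
  has matrix \<open>S + R\<close>, as the pure braid returns every strand to its place. Every symmetric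
  \<open>S\<close> with zero diagonal comes from a pure braid: the matrices of pure braids form an additive
  group, and a full twist of the strands \<open>i\<close> and \<open>j\<close>, conjugated by a braid that makes
  them neighbours, has the value 1 at \<open>(i, j)\<close> and \<open>(j, i)\<close> and 0 elsewhere
  (\<open>symmetric_in_pure_counts\<close>). An \<open>R\<close>-matrix comes from a positive braid: \<open>T0\<close>
  and \<open>T1\<close> say exactly that reversing the pairs marked by \<open>R\<close> in the natural order gives
  a linear order again, and sorting the strands into this order by swaps of neighbours crosses each
  marked pair once and no other pair (\<open>sorting_word\<close>).
\<close>

section \<open>Exchanging neighbouring strands\<close>

text \<open>
  An arrangement \<open>p\<close> gives the strand at each position, so the left-to-right order of two
  strands is read off from its inverse.
\<close>

abbreviation position :: "(nat \<Rightarrow> nat) \<Rightarrow> nat \<Rightarrow> nat" where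
  "position p \<equiv> inv_into UNIV p"

abbreviation swap_at :: "nat \<Rightarrow> (nat \<Rightarrow> nat) \<Rightarrow> nat \<Rightarrow> nat" where
  "swap_at k p \<equiv> p(k := p (Suc k), Suc k := p k)"

lemma swap_at_eq_comp: "swap_at k p = p \<circ> transpose k (Suc k)"
  by (auto simp: fun_eq_iff transpose_def)

lemma bij_swap_at: "bij p \<Longrightarrow> bij (swap_at k p)"
  unfolding swap_at_eq_comp by (intro bij_comp bij_swap_iff[THEN iffD2]) auto

lemma inv_swap_at: "bij p \<Longrightarrow> position (swap_at k p) s = transpose k (Suc k) (position p s)"
  unfolding swap_at_eq_comp by (subst o_inv_distrib) auto

lemma bij_end_positions: "bij p \<Longrightarrow> bij (end_positions p w)"
  by (induction p w rule: end_positions.induct) (simp_all add: bij_swap_at del: fun_upd_apply)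

text \<open>
  Since no position lies between \<open>k\<close> and \<open>Suc k\<close>, only the two
  exchanged strands change their relative order.
\<close>

lemma order_after_swap_at:
  assumes "bij p"
  shows "position (swap_at k p) s < position (swap_at k p) t \<longleftrightarrow>
    (position p s < position p t \<and> \<not> (s = p k \<and> t = p (Suc k))) \<or> (s = p (Suc k) \<and> t = p k)"
proof -
  have pos: "s = p a \<longleftrightarrow> position p s = a" for s a
    using assms by (metis bij_inv_eq_iff)
  show ?thesis
    unfolding inv_swap_at[OF assms] pos by (auto simp: transpose_def)
qed

lemma signed_count_Cons:
  "signed_count (PosCr a b # cs) s t = of_bool (s = a \<and> t = b) + signed_count cs s t"
  "signed_count (NegCr a b # cs) s t = signed_count cs s t - of_bool (s = a \<and> t = b)"
  by (auto simp: signed_count_def)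

text \<open>
  Each letter changes \<open>c\<^sub>s\<^sub>t - c\<^sub>t\<^sub>s\<close> by 1 if \<open>s\<close> crosses \<open>t\<close> from
  left to right and by -1 if it crosses from right to left; for a negative letter the change comes
  from the other of the two entries.
\<close>

lemma crossing_balance:
  assumes "bij p"
  shows "signed_count (crossings p w) s t - signed_count (crossings p w) t s =
    of_bool (position p s < position p t) -
    of_bool (position (end_positions p w) s < position (end_positions p w) t)"
  using assms
proof (induction w arbitrary: p)
  case (Cons l w)
  define k where "k = letter_index l"
  have ne: "p k \<noteq> p (Suc k)"
    using Cons.prems by (metis bij_pointE n_not_Suc_n)
  have pos: "s = p a \<longleftrightarrow> position p s = a" for s a
    using Cons.prems by (metis bij_inv_eq_iff)
  have step: "of_bool (position p s < position p t) -
      of_bool (position (swap_at k p) s < position (swap_at k p) t) =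
      (of_bool (s = p k \<and> t = p (Suc k)) - of_bool (t = p k \<and> s = p (Suc k)) :: int)"
    unfolding order_after_swap_at[OF Cons.prems] using ne by (auto simp: pos)
  have IH: "signed_count (crossings (swap_at k p) w) s t
        - signed_count (crossings (swap_at k p) w) t s =
      of_bool (position (swap_at k p) s < position (swap_at k p) t) -
      of_bool (position (end_positions p (l # w)) s < position (end_positions p (l # w)) t)"
    using Cons.IH[OF bij_swap_at[OF Cons.prems]] by (simp add: k_def del: fun_upd_apply)
  have "signed_count (crossings p (l # w)) s t - signed_count (crossings p (l # w)) t s =
      of_bool (s = p k \<and> t = p (Suc k)) - of_bool (t = p k \<and> s = p (Suc k)) +
      (signed_count (crossings (swap_at k p) w) s t
        - signed_count (crossings (swap_at k p) w) t s)"
    by (cases l) (auto simp: signed_count_Cons k_def conj_commute simp del: fun_upd_apply)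
  then show ?case
    unfolding IH step[symmetric] by simp
qed (simp add: signed_count_def)

section \<open>Crossing matrices have $SR$ decompositions\<close>

lemma SR_decomposable_crossing_matrix_word: "SR_decomposable N (crossing_matrix_word N w)"
proof -
  define q where "q = end_positions id w"
  define C where "C = crossing_matrix_word N w"
  define R :: "int mat" where
    "R = mat N N (\<lambda>(i, j). of_bool (i < j \<and> position q j < position q i))"
  have "bij q"
    by (simp add: q_def bij_end_positions)
  then have pos_ne: "position q i \<noteq> position q j" if "i \<noteq> j" for i j
    using that by (metis bij_inv_eq_iff)
  have C: "C \<in> carrier_mat N N" and R: "R \<in> carrier_mat N N"
    by (simp_all add: C_def R_def crossing_matrix_word_def)
  have balance:
    "C $$ (i, j) - C $$ (j, i) = of_bool (i < j) - of_bool (position q i < position q j)"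
    if "i < N" "j < N" for i j
    using that crossing_balance[OF bij_id, of w i j]
    by (auto simp: C_def crossing_matrix_word_def q_def inv_id)
  have "R_matrix R"
    using pos_ne by (fastforce simp: R_matrix_def T0_def T1_def R_def)
  moreover have "transpose_mat (C - R) = C - R"
  proof (rule eq_matI)
    fix i j assume "i < dim_row (C - R)" "j < dim_col (C - R)"
    then have ij: "i < N" "j < N" using R by auto
    have "C $$ (i, j) - C $$ (j, i) = R $$ (i, j) - R $$ (j, i)"
      using ij pos_ne[of i j] unfolding balance[OF ij] by (cases i j rule: linorder_cases) (auto simp: R_def)
    then show "transpose_mat (C - R) $$ (i, j) = (C - R) $$ (i, j)"
      using ij C R by simp
  qed (use C R in auto)
  moreover have "(C - R) $$ (i, i) = 0" if "i < N" for i
    using that by (simp add: C_def R_def crossing_matrix_word_def)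
  moreover have "C = (C - R) + R"
    by (rule eq_matI) (use C R in auto)
  moreover have "C - R \<in> carrier_mat N N"
    using R by (rule minus_carrier_mat)
  ultimately show ?thesis
    using R unfolding SR_decomposable_def C_def by blast
qed

section \<open>Symmetric matrices from pure braids\<close>

definition pure_counts :: "nat \<Rightarrow> (nat \<Rightarrow> nat \<Rightarrow> int) set" where
  "pure_counts N =
    {signed_count (crossings id w) | w. w \<in> braid_words N \<and> end_positions id w = id}"

lemma inv_word_inv_word: "inv_word (inv_word w) = w"
proof -
  have "inv_letter (inv_letter l) = l" for l by (cases l) auto
  then show ?thesis by (simp add: inv_word_def rev_map o_def)
qed

lemma inv_word_invariant:
  assumes "w \<in> braid_words N"
  shows "end_positions p (w @ inv_word w) = p"
    and "signed_count (crossings (end_positions p w) (inv_word w)) s t =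
      - signed_count (crossings p w) s t"
proof -
  have "braid_eq N (w @ inv_word w) []"
    using inv_word_left[OF inv_word_words[OF assms]] by (simp add: inv_word_inv_word)
  from braid_eq_invariant[OF this, of p s t]
  show "end_positions p (w @ inv_word w) = p"
    and "signed_count (crossings (end_positions p w) (inv_word w)) s t =
      - signed_count (crossings p w) s t"
    by (simp_all add: crossings_append signed_count_append) (simp add: signed_count_def)
qed

lemma pure_counts_zero: "(\<lambda>s t. 0) \<in> pure_counts N"
  unfolding pure_counts_def by (auto simp: signed_count_def fun_eq_iff intro!: exI[of _ "[]"])

lemma pure_counts_add:
  assumes "f \<in> pure_counts N" "g \<in> pure_counts N"
  shows "(\<lambda>s t. f s t + g s t) \<in> pure_counts N"
proof -
  from assms obtain u v where
    u: "u \<in> braid_words N" "end_positions id u = id" "f = signed_count (crossings id u)" and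
    v: "v \<in> braid_words N" "end_positions id v = id" "g = signed_count (crossings id v)"
    unfolding pure_counts_def by auto
  have "(\<lambda>s t. f s t + g s t) = signed_count (crossings id (u @ v))"
    by (simp add: u v crossings_append signed_count_append fun_eq_iff)
  moreover have "end_positions id (u @ v) = id"
    by (simp add: u v end_positions_append)
  ultimately show ?thesis
    unfolding pure_counts_def using u(1) v(1) append_braid_words by blast
qed

lemma pure_counts_minus:
  assumes "f \<in> pure_counts N"
  shows "(\<lambda>s t. - f s t) \<in> pure_counts N"
proof -
  from assms obtain u where
    u: "u \<in> braid_words N" "end_positions id u = id" "f = signed_count (crossings id u)"
    unfolding pure_counts_def by auto
  have "(\<lambda>s t. - f s t) = signed_count (crossings id (inv_word u))"
    using inv_word_invariant(2)[OF u(1), of id] by (simp add: u(2,3) fun_eq_iff)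
  moreover have "end_positions id (inv_word u) = id"
    using inv_word_invariant(1)[OF u(1), of id] by (simp add: u(2) end_positions_append)
  ultimately show ?thesis
    unfolding pure_counts_def using inv_word_words[OF u(1)] by blast
qed

lemma pure_counts_scale:
  assumes "f \<in> pure_counts N"
  shows "(\<lambda>s t. c * f s t) \<in> pure_counts N"
proof (induction c rule: int_induct[of _ 0])
  case base
  show ?case by (simp add: pure_counts_zero)
next
  case (step1 c)
  with pure_counts_add[OF step1(2) assms] show ?case by (simp add: algebra_simps)
next
  case (step2 c)
  with pure_counts_add[OF step2(2) pure_counts_minus[OF assms]] show ?case
    by (simp add: algebra_simps)
qed

definition twist_count :: "nat \<Rightarrow> nat \<Rightarrow> nat \<Rightarrow> nat \<Rightarrow> int" where
  "twist_count i j s t = of_bool (s = i \<and> t = j) + of_bool (s = j \<and> t = i)"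

lemma twist_count_commute: "twist_count i j s t = twist_count i j t s"
  by (simp only: twist_count_def conj_commute add.commute)

lemma word_making_neighbours:
  assumes "a < b" "b < N"
  shows "\<exists>u \<in> braid_words N. end_positions p u a = p a \<and> end_positions p u (Suc a) = p b"
  using assms
proof (induction b arbitrary: p)
  case (Suc b)
  show ?case
  proof (cases "a = b")
    case True
    then show ?thesis by (intro bexI[of _ "[]"]) auto
  next
    case False
    with Suc.prems have ab: "a < b" "b < N" by auto
    obtain u where u: "u \<in> braid_words N"
      "end_positions (swap_at b p) u a = swap_at b p a"
      "end_positions (swap_at b p) u (Suc a) = swap_at b p b"
      using Suc.IH[OF ab] by blast
    have "end_positions p (Sig b # u) = end_positions (swap_at b p) u"
      by (simp del: fun_upd_apply)
    with u ab have "end_positions p (Sig b # u) a = p a"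
      "end_positions p (Sig b # u) (Suc a) = p (Suc b)"
      by simp_all
    with u(1) Suc.prems show ?thesis
      by (intro bexI[of _ "Sig b # u"]) simp_all
  qed
qed simp

text \<open>
  In a conjugate \<open>u v u\<^sup>-\<^sup>1\<close> of a pure word \<open>v\<close>, the crossings of \<open>u\<close> and
  of its inverse involve the same strands and cancel, so only those of \<open>v\<close> count, with the
  strands that \<open>u\<close> has brought to their positions.
\<close>

lemma twist_in_pure_counts:
  assumes "i < j" "j < N"
  shows "twist_count i j \<in> pure_counts N"
proof -
  obtain u where u: "u \<in> braid_words N" "end_positions id u i = i" "end_positions id u (Suc i) = j"
    using word_making_neighbours[OF assms, of id] by auto
  define q where "q = end_positions id u"
  define v where "v = [Sig i, Sig i]"
  have "end_positions q v = q"
    by (auto simp: v_def fun_eq_iff)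
  then have "end_positions id (u @ v @ inv_word u) = id"
    using inv_word_invariant(1)[OF u(1), of id] by (simp add: end_positions_append q_def)
  moreover have "signed_count (crossings id (u @ v @ inv_word u)) s t = twist_count i j s t" for s t
  proof -
    have "signed_count (crossings id (u @ v @ inv_word u)) s t = signed_count (crossings q v) s t"
      using inv_word_invariant(2)[OF u(1), of id] \<open>end_positions q v = q\<close>
      by (simp add: crossings_append signed_count_append q_def)
    also have "\<dots> = twist_count i j s t"
      using u(2,3) by (simp add: v_def q_def signed_count_Cons twist_count_def) (simp add: signed_count_def)
    finally show ?thesis .
  qed
  moreover have "u @ v @ inv_word u \<in> braid_words N"
    using u assms by (simp add: v_def inv_word_words)
  ultimately show ?thesis
    unfolding pure_counts_def by (intro CollectI exI[of _ "u @ v @ inv_word u"]) (simp add: fun_eq_iff)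
qed

text \<open>
  A symmetric matrix with zero diagonal is an integer combination of twists. The induction
  clears one pair of entries at a time; \<open>Q\<close> holds the pairs that may still be nonzero.
\<close>

lemma symmetric_in_pure_counts:
  assumes "finite Q" "Q \<subseteq> {(i, j). i < j \<and> j < N}"
    and "\<And>s t. f s t = f t s"
    and "\<And>s t. f s t \<noteq> 0 \<Longrightarrow> (s, t) \<in> Q \<or> (t, s) \<in> Q"
  shows "f \<in> pure_counts N"
  using assms
proof (induction Q arbitrary: f rule: finite_induct)
  case empty
  then have "f = (\<lambda>s t. 0)" by (auto simp: fun_eq_iff)
  then show ?case by (simp add: pure_counts_zero)
next
  case (insert e Q)
  obtain i j where e: "e = (i, j)" by (cases e)
  with insert.prems have ij: "i < j" "j < N" by auto
  define g where "g s t = f s t - f i j * twist_count i j s t" for s t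
  have "g \<in> pure_counts N"
  proof (rule insert.IH)
    show "Q \<subseteq> {(i, j). i < j \<and> j < N}" using insert.prems by auto
    show "g s t = g t s" for s t
      by (simp only: g_def insert.prems(2)[of s t] twist_count_commute[of i j s t])
    fix s t assume ne: "g s t \<noteq> 0"
    have "twist_count i j i j = 1" "twist_count i j j i = 1"
      using ij by (simp_all add: twist_count_def)
    then have clear: "g i j = 0" "g j i = 0"
      by (simp_all add: g_def insert.prems(2)[of j i])
    with ne have st: "(s, t) \<noteq> (i, j)" "(s, t) \<noteq> (j, i)" by auto
    then have "\<not> (s = i \<and> t = j)" "\<not> (s = j \<and> t = i)" by blast+
    then have "twist_count i j s t = 0" by (simp only: twist_count_def of_bool_eq add_0)
    with ne have "f s t \<noteq> 0" by (simp add: g_def)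
    from insert.prems(3)[OF this] st show "(s, t) \<in> Q \<or> (t, s) \<in> Q"
      by (auto simp: e)
  qed
  from pure_counts_add[OF this pure_counts_scale[OF twist_in_pure_counts[OF ij], of "f i j"]]
  show ?case by (simp add: g_def)
qed

section \<open>$R$-matrices from positive braids\<close>

definition unsorted :: "(nat \<Rightarrow> nat \<Rightarrow> bool) \<Rightarrow> (nat \<Rightarrow> nat) \<Rightarrow> (nat \<times> nat) set" where
  "unsorted lt p = {(s, t). position p s < position p t \<and> lt t s}"

text \<open>
  Bubble sort: as long as some pair is unsorted, some pair of neighbours is, and exchanging it
  removes precisely this pair from the unsorted ones. The permutation is one of all natural numbers;
  the hypotheses on \<open>N\<close> ensure that only the first \<open>N\<close> positions are touched.
\<close>

lemma sorting_word:
  assumes "finite (unsorted lt p)" and "bij p"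
    and "transp lt" "asymp lt" "totalp lt"
    and "\<And>k. k \<ge> N \<Longrightarrow> p k = k"
    and "unsorted lt p \<subseteq> {..<N} \<times> {..<N}"
  shows "\<exists>w \<in> braid_words N. \<forall>s t.
    signed_count (crossings p w) s t = of_bool ((s, t) \<in> unsorted lt p)"
  using assms
proof (induction "card (unsorted lt p)" arbitrary: p rule: less_induct)
  case less
  have position_p: "position p (p a) = a" for a
    using less.prems(2) by (simp add: bij_is_inj)
  show ?case
  proof (cases "\<exists>k. lt (p (Suc k)) (p k)")
    case False
    have step: "lt (p a) (p (Suc a))" for a
      using False \<open>totalp lt\<close> position_p by (metis n_not_Suc_n totalpD)
    have "lt (p a) (p b)" if "a < b" for a b
      using that
      by (induction rule: less_Suc_induct) (use step \<open>transp lt\<close> in \<open>auto dest: transpD\<close>)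
    then have "lt s t" if "position p s < position p t" for s t
      using that less.prems(2) by (metis bij_inv_eq_iff)
    then have "unsorted lt p = {}"
      using \<open>asymp lt\<close> unfolding unsorted_def by (fast dest: asympD)
    then have "signed_count (crossings p []) s t = of_bool ((s, t) \<in> unsorted lt p)" for s t
      by (simp add: signed_count_def)
    then show ?thesis
      using Nil_braid_words by blast
  next
    case True
    then obtain k where k: "lt (p (Suc k)) (p k)" by blast
    let ?e = "(p k, p (Suc k))" and ?p = "swap_at k p"
    have mem: "?e \<in> unsorted lt p"
      using k by (simp add: unsorted_def position_p)
    then have "p (Suc k) < N"
      using less.prems(7) by auto
    then have kN: "Suc k < N"
      using less.prems(6)[of "Suc k"] by (metis not_less)
    have un: "unsorted lt ?p = unsorted lt p - {?e}"
    proof (rule Set.set_eqI, unfold split_paired_all)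
      fix s t
      have "\<not> lt (p k) (p (Suc k))"
        using \<open>asymp lt\<close> k by (rule asympD)
      then show "(s, t) \<in> unsorted lt ?p \<longleftrightarrow> (s, t) \<in> unsorted lt p - {?e}"
        unfolding unsorted_def mem_Collect_eq prod.case Diff_iff singleton_iff prod.inject
          order_after_swap_at[OF less.prems(2)]
        by metis
    qed
    have "\<exists>w \<in> braid_words N. \<forall>s t.
        signed_count (crossings ?p w) s t = of_bool ((s, t) \<in> unsorted lt ?p)"
    proof (rule less.hyps)
      show "card (unsorted lt ?p) < card (unsorted lt p)"
        unfolding un using mem less.prems(1) by (metis card_Diff1_less)
      show "finite (unsorted lt ?p)" "unsorted lt ?p \<subseteq> {..<N} \<times> {..<N}"
        unfolding un using less.prems(1,7) by auto
      show "bij ?p" using less.prems(2) by (rule bij_swap_at)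
      show "?p a = a" if "a \<ge> N" for a
        using that kN less.prems(6) by auto
    qed fact+
    then obtain w where w: "w \<in> braid_words N"
      "\<And>s t. signed_count (crossings ?p w) s t = of_bool ((s, t) \<in> unsorted lt ?p)"
      by blast
    then show ?thesis
      using mem kN
      by (intro bexI[of _ "Sig k # w"])
        (auto simp: signed_count_Cons un simp del: fun_upd_apply)
  qed
qed

text \<open>
  \<open>lt\<close> is the natural order with the pairs marked by \<open>R\<close> reversed. Its transitivity
  on the six arrangements of three strands is what \<open>T0\<close> and \<open>T1\<close> provide; from the
  identity, the unsorted pairs are the marked ones.
\<close>

lemma R_matrix_word:
  assumes R: "R \<in> carrier_mat N N" "R_matrix R"
  shows "\<exists>w \<in> braid_words N. \<forall>i < N. \<forall>j < N.
    signed_count (crossings id w) i j = R $$ (i, j)"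
proof -
  define r where "r i j \<longleftrightarrow> i < j \<and> j < N \<and> R $$ (i, j) \<noteq> 0" for i j
  define lt where "lt i j \<longleftrightarrow> (i < j \<and> \<not> r i j) \<or> (j < i \<and> r j i)" for i j
  have T0: "\<not> r i j" if "i < k" "k < j" "\<not> r i k" "\<not> r k j" for i k j
    using R that unfolding R_matrix_def T0_def r_def by auto
  have T1: "r i j" if "i < k" "k < j" "r i k" "r k j" for i k j
    using R that unfolding R_matrix_def T1_def r_def by auto
  have "transp lt"
  proof (rule transpI)
    fix a b c assume ab: "lt a b" and bc: "lt b c"
    then have "a \<noteq> b" "b \<noteq> c" "a \<noteq> c"
      by (auto simp: lt_def)
    then consider "a < b" "b < c" | "a < c" "c < b" | "b < a" "a < c"
      | "b < c" "c < a" | "c < a" "a < b" | "c < b" "b < a"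
      by linarith
    then show "lt a c"
    proof cases
      case 1 with T0[of a b c] ab bc show ?thesis by (simp add: lt_def)
    next
      case 2 with T1[of a c b] ab bc show ?thesis by (auto simp: lt_def)
    next
      case 3 with T1[of b a c] ab bc show ?thesis by (auto simp: lt_def)
    next
      case 4 with T0[of b c a] ab bc show ?thesis by (auto simp: lt_def)
    next
      case 5 with T0[of c a b] ab bc show ?thesis by (auto simp: lt_def)
    next
      case 6 with T1[of c b a] ab bc show ?thesis by (simp add: lt_def)
    qed
  qed
  moreover have "asymp lt" by (rule asympI) (auto simp: lt_def)
  moreover have "totalp lt" by (rule totalpI) (auto simp: lt_def)
  moreover have un: "unsorted lt id = {(s, t). r s t}"
    by (auto simp: unsorted_def lt_def r_def)
  moreover have sub: "unsorted lt id \<subseteq> {..<N} \<times> {..<N}"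
    unfolding un by (auto simp: r_def)
  moreover have "finite (unsorted lt id)"
    using sub by (rule finite_subset) simp
  ultimately obtain w where w: "w \<in> braid_words N"
    "\<And>s t. signed_count (crossings id w) s t = of_bool (r s t)"
    using sorting_word[of lt id N] by auto
  have "signed_count (crossings id w) i j = R $$ (i, j)" if "i < N" "j < N" for i j
    using R that unfolding R_matrix_def r_def w(2) by (cases "i < j") auto
  with w(1) show ?thesis by blast
qed

theorem theorem11:
  fixes N :: nat and A :: "int mat"
  assumes "N \<ge> 1" and "A \<in> carrier_mat N N"
  shows "(\<exists>b \<in> carrier (braid_group N). A = crossing_matrix N b) \<longleftrightarrow> SR_decomposable N A"
proof
  assume "\<exists>b \<in> carrier (braid_group N). A = crossing_matrix N b"
  then obtain w where "w \<in> braid_words N" "A = crossing_matrix N (braid_rel N `` {w})"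
    by (auto simp: braid_group_def elim: quotientE)
  then show "SR_decomposable N A"
    by (simp add: crossing_matrix_class SR_decomposable_crossing_matrix_word)
next
  assume "SR_decomposable N A"
  then obtain S R where
    S: "S \<in> carrier_mat N N" "transpose_mat S = S" "\<And>i. i < N \<Longrightarrow> S $$ (i, i) = 0"
    and R: "R \<in> carrier_mat N N" "R_matrix R" and A: "A = S + R"
    unfolding SR_decomposable_def by auto
  obtain v where v: "v \<in> braid_words N"
    "\<And>i j. i < N \<Longrightarrow> j < N \<Longrightarrow> signed_count (crossings id v) i j = R $$ (i, j)"
    using R_matrix_word[OF R] by blast
  define f where "f i j = (if i < N \<and> j < N then S $$ (i, j) else 0)" for i j
  have "f \<in> pure_counts N"
  proof (rule symmetric_in_pure_counts)
    have "{(i, j). i < j \<and> j < N} \<subseteq> {..<N} \<times> {..<N}" by auto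
    then show "finite {(i, j). i < j \<and> j < N}" by (rule finite_subset) simp
    show "f s t = f t s" for s t
      using S(1) index_transpose_mat(1)[of t S s] by (auto simp: f_def S(2))
    show "(s, t) \<in> {(i, j). i < j \<and> j < N} \<or> (t, s) \<in> {(i, j). i < j \<and> j < N}"
      if "f s t \<noteq> 0" for s t
      using that S(3)[of s] by (cases s t rule: linorder_cases) (auto simp: f_def split: if_splits)
  qed simp
  then obtain u where u: "u \<in> braid_words N" "end_positions id u = id"
    "f = signed_count (crossings id u)"
    unfolding pure_counts_def by auto
  have "A = crossing_matrix_word N (u @ v)"
  proof (rule eq_matI)
    fix i j assume "i < dim_row (crossing_matrix_word N (u @ v))"
      "j < dim_col (crossing_matrix_word N (u @ v))"
    then have ij: "i < N" "j < N" by (auto simp: crossing_matrix_word_def)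
    have "R $$ (i, i) = 0"
      using R ij unfolding R_matrix_def by auto
    with ij S R v(2)[OF ij] fun_cong[OF fun_cong[OF u(3)], of i j]
    show "A $$ (i, j) = crossing_matrix_word N (u @ v) $$ (i, j)"
      by (auto simp: A crossing_matrix_word_def crossings_append signed_count_append u(2) f_def)
  qed (use S R in \<open>auto simp: A crossing_matrix_word_def\<close>)
  moreover have "u @ v \<in> braid_words N"
    using u v by simp
  ultimately show "\<exists>b \<in> carrier (braid_group N). A = crossing_matrix N b"
    by (intro bexI[of _ "braid_rel N `` {u @ v}"])
      (auto simp: crossing_matrix_class braid_group_def intro: quotientI)
qed

end
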